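(* Assume that for every $A>0$, \[\sum_{n\le x}\mu(n+2)\mu(n+1)\exp(2\pi i n\beta)=O\Bigl(\frac{x}{(\log x)^A}\Bigr)\] uniformly for all real $\beta$ (where $\mu$ is the Möbius function). Let $g_1:\mathbb{N}\to\mathbb{C}$ be a multiplicative function with $|g_1(n)|\le1$ for all $n$ and $\sum_p\frac{|g_1(p)-1|^2}{p}<\infty$. Then, as $x\to\infty$, \[\frac1x\sum_{n\le x}g_1(n+3)\mu(n+2)\mu(n+1)=o(1).\]
   Context: $p$ runs over primes. *)

theory Defs
  imports
    "HOL-Analysis.Analysis"
    "HOL-Library.Landau_Symbols"
    "HOL-Computational_Algebra.Computational_Algebra"
begin

definition moebius_mu :: "nat \<Rightarrow> int" where
  "moebius_mu n = (if squarefree n then (-1) ^ card (prime_factors n) else 0)"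

text \<open>
  Arithmetic functions are modelled as functions on all of \<^typ>\<open>nat\<close>; only their values at
  positive arguments are meaningful, so nothing is required at \<open>0\<close>.
\<close>
definition multiplicative_fun :: "(nat \<Rightarrow> complex) \<Rightarrow> bool" where
  "multiplicative_fun g \<longleftrightarrow>
     g 1 = 1 \<and> (\<forall>m n. m > 0 \<longrightarrow> n > 0 \<longrightarrow> coprime m n \<longrightarrow> g (m * n) = g m * g n)"

end

theory Submission
  imports Defs
begin

text \<open>
  Fix a large \<open>y\<close> and let \<open>Q = (y!)\<^sup>K\<close>. For all \<open>m \<le> N\<close> outside a set of small density, \<open>g m\<close>
  factors as \<open>g (gcd m Q)\<close> times the product of \<open>g p\<close> over the primes \<open>p > y\<close> dividing \<open>m\<close>.
  For \<open>p\<^sup>2 \<le> N\<close> replace \<open>g p\<close> by \<open>exp (g p - 1)\<close>; by a Turan--Kubilius inequality the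
  resulting exponent is on average close to the constant \<open>A = \<Sum> (g p - 1) / p\<close>. At most one prime
  with \<open>p\<^sup>2 > N\<close> divides \<open>m\<close>, so by Cauchy--Schwarz these contribute little. All errors are controlled
  by the tail of \<open>\<Sum> |g p - 1|\<^sup>2 / p\<close>. Hence \<open>g\<close> is close in mean to a constant of modulus at
  most 1 (depending on \<open>N\<close>) times the function \<open>g (gcd m Q)\<close>, which is periodic with a period
  independent of \<open>N\<close>. Sums of the Moebius products against periodic functions are combinations of
  the exponential sums in the hypothesis, hence negligible.
\<close>

section \<open>Counting multiples and first moments\<close>

lemma sum_of_bool_dvd:
  fixes d N :: nat
  assumes "d > 0"
  shows "(\<Sum>m=1..N. of_bool (d dvd m) :: 'a :: semiring_1) = of_nat (N div d)"
proof -
  have "{m \<in> {1..N}. d dvd m} = (\<lambda>k. d * k) ` {1..N div d}"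
  proof (intro equalityI subsetI)
    fix m assume "m \<in> {m \<in> {1..N}. d dvd m}"
    then obtain k where "m = d * k" "1 \<le> d * k" "d * k \<le> N" by auto
    moreover from this assms have "k \<le> N div d"
      by (simp add: less_eq_div_iff_mult_less_eq mult.commute)
    moreover from calculation have "k \<ge> 1" by (cases k) auto
    ultimately show "m \<in> (\<lambda>k. d * k) ` {1..N div d}" by auto
  next
    fix m assume "m \<in> (\<lambda>k. d * k) ` {1..N div d}"
    then show "m \<in> {m \<in> {1..N}. d dvd m}"
      using assms by (auto simp: less_eq_div_iff_mult_less_eq mult.commute Suc_le_eq)
  qed
  moreover have "card ((\<lambda>k. d * k) ` {1..N div d}) = N div d"
    using assms by (subst card_image) (auto simp: inj_on_def)
  moreover have "(\<Sum>m=1..N. of_bool (d dvd m) :: 'a) = of_nat (card {m \<in> {1..N}. d dvd m})"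
    by (simp add: of_bool_def sum.inter_filter [symmetric])
  ultimately show ?thesis by simp
qed

lemma real_div_bounds:
  fixes N d :: nat
  assumes "d > 0"
  shows "real (N div d) \<le> real N / real d" "real N / real d - 1 \<le> real (N div d)"
proof -
  have eq: "real N = real d * real (N div d) + real (N mod d)"
    by (simp flip: of_nat_mult of_nat_add)
  have "real (N mod d) < real d" using assms by simp
  with eq assms show "real (N div d) \<le> real N / real d" "real N / real d - 1 \<le> real (N div d)"
    by (simp_all add: field_simps)
qed

text \<open>After swapping the sums, each \<open>d\<close> contributes at most \<open>N / d\<close>
  multiples. Averages over \<open>m\<close> of weighted divisor sums thus become sums against
  \<open>1 / d\<close>.\<close>

lemma sum_sum_dvd_le:
  fixes w :: "nat \<Rightarrow> real" and N :: nat
  assumes "\<And>d. d \<in> D \<Longrightarrow> d > 0" "\<And>d. d \<in> D \<Longrightarrow> w d \<ge> 0"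
  shows "(\<Sum>m=1..N. \<Sum>d\<in>D. w d * of_bool (d dvd m)) \<le> real N * (\<Sum>d\<in>D. w d / real d)"
proof -
  have "(\<Sum>m=1..N. \<Sum>d\<in>D. w d * of_bool (d dvd m)) = (\<Sum>d\<in>D. w d * (\<Sum>m=1..N. of_bool (d dvd m)))"
    by (subst sum.swap) (simp only: sum_distrib_left)
  also have "\<dots> \<le> (\<Sum>d\<in>D. w d * (real N / real d))"
    using assms by (intro sum_mono mult_left_mono) (simp_all only: sum_of_bool_dvd real_div_bounds)
  finally show ?thesis by (simp add: sum_distrib_left mult_ac)
qed

text \<open>Cauchy-Schwarz against the constant function 1; it turns second-moment bounds into
  bounds for means.\<close>

lemma sum_le_of_sum_squares_le:
  fixes h :: "nat \<Rightarrow> real" and N :: nat and c :: real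
  assumes "(\<Sum>m=1..N. (h m)\<^sup>2) \<le> real N * c\<^sup>2" "c \<ge> 0"
  shows "(\<Sum>m=1..N. h m) \<le> real N * c"
proof (rule power2_le_imp_le)
  have "(\<Sum>m=1..N. h m * 1)\<^sup>2 \<le> (\<Sum>m=1..N. (h m)\<^sup>2) * (\<Sum>m=1..N. 1\<^sup>2)"
    by (rule Cauchy_Schwarz_ineq_sum)
  also have "\<dots> \<le> (real N * c\<^sup>2) * real N"
    using assms by (intro mult_mono) auto
  finally show "(\<Sum>m=1..N. h m)\<^sup>2 \<le> (real N * c)\<^sup>2" by (simp add: power2_eq_square mult_ac)
qed (use assms in auto)

section \<open>A Turan-Kubilius inequality for primes up to the square root\<close>

text \<open>The factors are divisibility indicators centred at their densities. For distinct primes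
  the four terms of the expanded product all have main part \<open>N / (p * q)\<close>, and these
  cancel, leaving only rounding errors. For \<open>p = q\<close> the sum is essentially a variance,
  of size \<open>N / p\<close>.\<close>

lemma divisor_correlation_bound:
  fixes p q N :: nat
  assumes "prime p" "prime q"
  shows "\<bar>\<Sum>m=1..N. (of_bool (p dvd m) - 1 / real p) * (of_bool (q dvd m) - 1 / real q)\<bar>
           \<le> 1 + of_bool (p = q) * (2 * real N / real p)"
proof -
  have pos: "p > 0" "q > 0" and ge2: "p \<ge> 2" "q \<ge> 2"
    using assms prime_gt_0_nat prime_ge_2_nat by auto
  define T where "T = (\<Sum>m=1..N. (of_bool (p dvd m) - 1 / real p) * (of_bool (q dvd m) - 1 / real q))"
  have T: "T = (\<Sum>m=1..N. of_bool (p dvd m \<and> q dvd m)) - (1 / real q) * real (N div p) - (1 / real p) * real (N div q)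
              + real N / (real p * real q)"
  proof -
    have "T = (\<Sum>m=1..N. of_bool (p dvd m \<and> q dvd m) - (1 / real q) * of_bool (p dvd m)
                - (1 / real p) * of_bool (q dvd m) + 1 / (p * real q))"
      unfolding T_def by (intro sum.cong) (auto simp: of_bool_def algebra_simps)
    also have "\<dots> = (\<Sum>m=1..N. of_bool (p dvd m \<and> q dvd m))
        - (1 / real q) * (\<Sum>m=1..N. of_bool (p dvd m)) - (1 / real p) * (\<Sum>m=1..N. of_bool (q dvd m)) + real N / (real p * real q)"
      by (simp only: sum.distrib sum_subtractf sum_distrib_left [symmetric]) simp
    finally show ?thesis using pos by (simp only: sum_of_bool_dvd)
  qed
  show ?thesis
  proof (cases "p = q")
    case True
    have "T \<ge> 0" unfolding T_def True by (intro sum_nonneg) simp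
    moreover have "T \<le> 2 * real N / real p"
    proof -
      have "T = real (N div p) - 2 * ((1 / real p) * real (N div p)) + real N / (real p * real p)"
        using pos unfolding T True by (simp only: conj_absorb sum_of_bool_dvd)
      moreover have "(1 / real p) * real (N div p) \<ge> 0" by (intro mult_nonneg_nonneg) auto
      moreover have "N / (real p * real p) \<le> real N / real p"
        using pos by (intro divide_left_mono) auto
      moreover have "2 * real N / real p = real N / real p + real N / real p" by simp
      ultimately show ?thesis using real_div_bounds(1)[OF pos(1), of N] by linarith
    qed
    ultimately show ?thesis using True unfolding T_def by simp
  next
    case False
    then have "coprime p q" using assms primes_coprime by auto
    then have eq: "of_bool (p dvd m \<and> q dvd m) = (of_bool ((p * q) dvd m) :: real)" for m
      using divides_mult[of p m q] dvd_mult_left[of p q m] dvd_mult_right[of p q m] by auto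
    define \<alpha> \<beta> \<gamma> \<delta> where "\<alpha> = (1 / real q) * real (N div p)" and "\<beta> = (1 / real p) * real (N div q)"
      and "\<gamma> = real N / (real p * real q)" and "\<delta> = real (N div (p * q))"
    have "T = \<delta> - \<alpha> - \<beta> + \<gamma>"
      using pos unfolding T eq \<alpha>_def \<beta>_def \<gamma>_def \<delta>_def by (subst sum_of_bool_dvd) auto
    moreover have "\<alpha> \<le> (1 / real q) * (real N / real p)" "\<beta> \<le> (1 / real p) * (real N / real q)"
      "(1 / real q) * (real N / real p - 1) \<le> \<alpha>" "(1 / real p) * (real N / real q - 1) \<le> \<beta>"
      unfolding \<alpha>_def \<beta>_def using pos by (intro mult_left_mono real_div_bounds; simp)+
    then have "\<alpha> \<le> \<gamma>" "\<beta> \<le> \<gamma>" "\<gamma> - 1 / real q \<le> \<alpha>" "\<gamma> - 1 / real p \<le> \<beta>"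
      using pos by (simp_all add: \<gamma>_def right_diff_distrib mult.commute)
    \<comment> \<open>For the upper bound the roundings in \<open>\<alpha>\<close> and
      \<open>\<beta>\<close> cost \<open>1 / q + 1 / p\<close>, which is at most 1 because primes
      are at least 2. For the lower bound only the rounding in \<open>\<delta>\<close> costs
      anything.\<close>
    moreover have "1 / real q \<le> 1 / 2" "1 / real p \<le> 1 / 2"
      using ge2 by (intro divide_left_mono; simp)+
    moreover have "\<delta> \<le> \<gamma>" "\<gamma> - 1 \<le> \<delta>"
      unfolding \<gamma>_def \<delta>_def using real_div_bounds[of "p * q" N] pos by simp_all
    ultimately have "\<bar>T\<bar> \<le> 1" by linarith
    then show ?thesis using False unfolding T_def by simp
  qed
qed

text \<open>Since only primes up to \<open>\<surd>N\<close> are admitted, the off-diagonal terms are harmless and no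
  estimate for the number of primes is needed.\<close>
lemma turan_kubilius_sqrt:
  fixes z :: "nat \<Rightarrow> complex" and N :: nat
  assumes P: "finite P" "\<And>p. p \<in> P \<Longrightarrow> prime p" "\<And>p. p \<in> P \<Longrightarrow> p * p \<le> N"
  shows "(\<Sum>m=1..N. (norm (\<Sum>p\<in>P. z p * of_real (of_bool (p dvd m) - 1 / real p)))\<^sup>2)
           \<le> 3 * real N * (\<Sum>p\<in>P. (norm (z p))\<^sup>2 / real p)"
proof -
  define t where "t p m = (of_bool (p dvd m) - 1 / real p)" for p m :: nat
  define S where "S = (\<Sum>p\<in>P. (norm (z p))\<^sup>2 / real p)"
  have pos: "p > 0" if "p \<in> P" for p using P(2)[OF that] by (simp add: prime_gt_0_nat)
  \<comment> \<open>The expansion is carried out over the complex numbers, where the squared modulus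
    is a product with the conjugate and the square opens into a double sum.\<close>
  have "complex_of_real (\<Sum>m=1..N. (norm (\<Sum>p\<in>P. z p * of_real (of_bool (p dvd m) - 1 / real p)))\<^sup>2)
        = (\<Sum>m=1..N. \<Sum>p\<in>P. \<Sum>q\<in>P. z p * cnj (z q) * of_real (t p m * t q m))"
    unfolding of_real_sum
  proof (intro sum.cong refl)
    fix m
    have "(\<Sum>p\<in>P. z p * of_real (of_bool (p dvd m) - 1 / real p)) = (\<Sum>p\<in>P. z p * of_real (t p m))"
      by (simp add: t_def)
    then show "complex_of_real ((norm (\<Sum>p\<in>P. z p * of_real (of_bool (p dvd m) - 1 / real p)))\<^sup>2)
        = (\<Sum>p\<in>P. \<Sum>q\<in>P. z p * cnj (z q) * of_real (t p m * t q m))"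
      by (simp add: complex_norm_square sum_product mult_ac del: of_real_power)
  qed
  also have "\<dots> = (\<Sum>p\<in>P. \<Sum>q\<in>P. z p * cnj (z q) * of_real (\<Sum>m=1..N. t p m * t q m))"
    by (subst sum.swap, rule sum.cong [OF refl], subst sum.swap) (simp add: sum_distrib_left)
  finally have expand: "complex_of_real (\<Sum>m=1..N. (norm (\<Sum>p\<in>P. z p * of_real (of_bool (p dvd m) - 1 / real p)))\<^sup>2)
      = (\<Sum>p\<in>P. \<Sum>q\<in>P. z p * cnj (z q) * of_real (\<Sum>m=1..N. t p m * t q m))" .
  have "(\<Sum>m=1..N. (norm (\<Sum>p\<in>P. z p * of_real (of_bool (p dvd m) - 1 / real p)))\<^sup>2)
      \<le> norm (\<Sum>p\<in>P. \<Sum>q\<in>P. z p * cnj (z q) * of_real (\<Sum>m=1..N. t p m * t q m))"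
    unfolding expand [symmetric] norm_of_real by (rule abs_ge_self)
  also have "\<dots> \<le> (\<Sum>p\<in>P. \<Sum>q\<in>P. norm (z p) * norm (z q) * (1 + of_bool (p = q) * (2 * real N / real p)))"
  proof (intro sum_norm_le)
    fix p q assume "p \<in> P" "q \<in> P"
    have "norm (z p * cnj (z q) * of_real (\<Sum>m=1..N. t p m * t q m))
        = norm (z p) * norm (z q) * \<bar>\<Sum>m=1..N. t p m * t q m\<bar>"
      by (simp only: norm_mult norm_of_real complex_mod_cnj)
    also have "\<dots> \<le> norm (z p) * norm (z q) * (1 + of_bool (p = q) * (2 * real N / real p))"
      unfolding t_def using P(2)[OF \<open>p \<in> P\<close>] P(2)[OF \<open>q \<in> P\<close>]
      by (intro mult_left_mono divisor_correlation_bound) auto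
    finally show "norm (z p * cnj (z q) * of_real (\<Sum>m=1..N. t p m * t q m))
        \<le> norm (z p) * norm (z q) * (1 + of_bool (p = q) * (2 * real N / real p))" .
  qed
  also have "\<dots> = (\<Sum>p\<in>P. norm (z p))\<^sup>2 + 2 * real N * S"
  proof -
    have "(\<Sum>q\<in>P. norm (z p) * norm (z q) * (1 + of_bool (p = q) * (2 * real N / real p)))
        = norm (z p) * (\<Sum>q\<in>P. norm (z q)) + 2 * real N * ((norm (z p))\<^sup>2 / real p)" if "p \<in> P" for p
    proof -
      have "(\<Sum>q\<in>P. norm (z p) * norm (z q) * (1 + of_bool (p = q) * (2 * real N / real p)))
        = (\<Sum>q\<in>P. norm (z p) * norm (z q) + (if p = q then 2 * real N * ((norm (z p))\<^sup>2 / real p) else 0))"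
        by (intro sum.cong) (auto simp: power2_eq_square algebra_simps)
      then show ?thesis using that P(1) by (simp add: sum.distrib sum_distrib_left)
    qed
    then have "(\<Sum>p\<in>P. \<Sum>q\<in>P. norm (z p) * norm (z q) * (1 + of_bool (p = q) * (2 * real N / real p)))
        = (\<Sum>p\<in>P. norm (z p) * (\<Sum>q\<in>P. norm (z q)) + 2 * real N * ((norm (z p))\<^sup>2 / real p))"
      by (rule sum.cong [OF refl])
    then show ?thesis
      by (simp only: sum.distrib S_def power2_eq_square [of "\<Sum>p\<in>P. norm (z p)"]
            sum_distrib_right [symmetric] sum_distrib_left [symmetric])
  qed
  \<comment> \<open>Cauchy-Schwarz with weights \<open>sqrt p\<close> bounds the off-diagonal part
    by \<open>S\<close> times the sum of the primes in \<open>P\<close>.\<close>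
  also have "(\<Sum>p\<in>P. norm (z p))\<^sup>2 \<le> real N * S"
  proof -
    have "(\<Sum>p\<in>P. norm (z p))\<^sup>2 = (\<Sum>p\<in>P. (norm (z p) / sqrt (real p)) * sqrt (real p))\<^sup>2"
      using pos by (intro arg_cong[where f = "\<lambda>x. x\<^sup>2"] sum.cong) auto
    also have "\<dots> \<le> (\<Sum>p\<in>P. (norm (z p) / sqrt (real p))\<^sup>2) * (\<Sum>p\<in>P. (sqrt (real p))\<^sup>2)"
      by (rule Cauchy_Schwarz_ineq_sum)
    also have "\<dots> = S * real (\<Sum>P)"
      by (simp add: S_def power_divide)
    also have "\<dots> \<le> S * real N"
    proof -
      \<comment> \<open>If \<open>M\<close> is the largest element of \<open>P\<close>, there are at
        most \<open>M\<close> elements, each at most \<open>M\<close>, and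
        \<open>M * M \<le> N\<close>.\<close>
      have "\<Sum>P \<le> N"
      proof (cases "P = {}")
        case False
        define M where "M = Max P"
        have "M \<in> P" and M: "\<And>p. p \<in> P \<Longrightarrow> p \<le> M" using P(1) False by (auto simp: M_def)
        have "P \<subseteq> {1..M}" using M pos by (auto simp: Suc_le_eq)
        then have "card P \<le> M" using card_mono[of "{1..M}" P] by simp
        have "\<Sum>P \<le> card P * M" using sum_bounded_above[of P "\<lambda>p. p" M] M by simp
        also have "\<dots> \<le> M * M" using \<open>card P \<le> M\<close> by simp
        finally show ?thesis using P(3)[OF \<open>M \<in> P\<close>] by simp
      qed simp
      moreover have "S \<ge> 0" unfolding S_def by (intro sum_nonneg) simp
      ultimately show ?thesis by (intro mult_left_mono) linarith+
    qed
    finally show ?thesis by (simp add: mult_ac)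
  qed
  finally show ?thesis by (simp add: S_def algebra_simps)
qed

section \<open>Primes above the square root\<close>

text \<open>The product of two distinct primes in \<open>L\<close> exceeds \<open>N\<close>, so each
  \<open>m\<close> has at most one prime factor in \<open>L\<close>. Squaring the inner sum
  therefore leaves only diagonal terms, and the second moment controls the first.\<close>

lemma sum_large_prime_divisors_le:
  fixes w :: "nat \<Rightarrow> real" and N :: nat
  assumes L: "finite L" "\<And>p. p \<in> L \<Longrightarrow> prime p" "\<And>p. p \<in> L \<Longrightarrow> N < p * p"
    and c: "(\<Sum>p\<in>L. (w p)\<^sup>2 / real p) \<le> c\<^sup>2" "c \<ge> 0"
  shows "(\<Sum>m=1..N. \<Sum>p\<in>L. w p * of_bool (p dvd m)) \<le> real N * c"
proof (rule sum_le_of_sum_squares_le)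
  have "(\<Sum>p\<in>L. w p * of_bool (p dvd m))\<^sup>2 = (\<Sum>p\<in>L. (w p)\<^sup>2 * of_bool (p dvd m))"
    if "m \<in> {1..N}" for m
  proof -
    have "(\<Sum>p\<in>L. w p * of_bool (p dvd m))\<^sup>2
        = (\<Sum>p\<in>L. \<Sum>q\<in>L. w p * w q * of_bool (p dvd m \<and> q dvd m))"
      by (simp add: power2_eq_square sum_product of_bool_conj mult_ac)
    also have "\<dots> = (\<Sum>p\<in>L. \<Sum>q\<in>L. if p = q then (w p)\<^sup>2 * of_bool (p dvd m) else 0)"
    proof (intro sum.cong refl)
      fix p q assume "p \<in> L" "q \<in> L"
      have "\<not> (p dvd m \<and> q dvd m)" if "p \<noteq> q"
      proof
        assume "p dvd m \<and> q dvd m"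
        then have "p * q dvd m"
          using divides_mult primes_coprime[OF L(2)[OF \<open>p \<in> L\<close>] L(2)[OF \<open>q \<in> L\<close>] that] by blast
        then have "p * q \<le> N" using \<open>m \<in> {1..N}\<close> dvd_imp_le[of "p * q" m] by auto
        then have "(p * q) * (p * q) \<le> N * N" by (intro mult_mono) auto
        moreover have "N * N < (p * p) * (q * q)"
          using L(3)[OF \<open>p \<in> L\<close>] L(3)[OF \<open>q \<in> L\<close>] by (intro mult_strict_mono') auto
        ultimately show False by (simp add: mult_ac)
      qed
      then show "w p * w q * of_bool (p dvd m \<and> q dvd m)
          = (if p = q then (w p)\<^sup>2 * of_bool (p dvd m) else 0)"
        by (auto simp: power2_eq_square)
    qed
    finally show ?thesis using L(1) by simp
  qed
  then have "(\<Sum>m=1..N. (\<Sum>p\<in>L. w p * of_bool (p dvd m))\<^sup>2)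
      = (\<Sum>m=1..N. \<Sum>p\<in>L. (w p)\<^sup>2 * of_bool (p dvd m))" by (intro sum.cong) auto
  also have "\<dots> \<le> real N * (\<Sum>p\<in>L. (w p)\<^sup>2 / real p)"
    using L(2) by (intro sum_sum_dvd_le) (auto simp: prime_gt_0_nat)
  also have "\<dots> \<le> real N * c\<^sup>2" using c by (intro mult_left_mono) auto
  finally show "(\<Sum>m=1..N. (\<Sum>p\<in>L. w p * of_bool (p dvd m))\<^sup>2) \<le> real N * c\<^sup>2" .
qed (use c in auto)

section \<open>Estimates for the exponential and for tails of sums\<close>

text \<open>The closed left half plane is convex, and there the derivative of \<open>exp\<close> has
  modulus at most 1.\<close>

lemma norm_exp_diff_le:
  fixes u v :: complex
  assumes "Re u \<le> 0" "Re v \<le> 0"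
  shows "norm (exp u - exp v) \<le> norm (u - v)"
proof -
  have "norm (exp u - exp v) \<le> 1 * norm (u - v)"
  proof (rule field_differentiable_bound)
    show "convex {z. Re z \<le> 0}" by (rule convex_halfspace_Re_le)
    show "(exp has_field_derivative exp z) (at z within {z. Re z \<le> 0})" for z :: complex
      by (rule DERIV_exp [THEN DERIV_subset]) simp
  qed (use assms in auto)
  then show ?thesis by simp
qed

text \<open>With \<open>z = g p - 1\<close> this is the cost of replacing \<open>g p\<close> by
  \<open>exp (g p - 1)\<close>: a first-order Taylor remainder, hence quadratic in \<open>z\<close>.
  The hypothesis forces \<open>norm z \<le> 2\<close>, which makes the constant absolute.\<close>

lemma norm_one_plus_minus_exp_le:
  fixes z :: complex
  assumes "norm (1 + z) \<le> 1"
  shows "norm (1 + z - exp z) \<le> exp 2 * (norm z)\<^sup>2"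
proof -
  have "norm z \<le> 2" using norm_triangle_ineq4[of "1 + z" 1] assms by simp
  then have "\<bar>Re z\<bar> \<le> 2" using abs_Re_le_cmod[of z] by linarith
  have "norm (1 + z - exp z) \<le> exp \<bar>Re z\<bar> * (norm z)\<^sup>2"
    using Taylor_exp[of z 1] by (simp add: norm_minus_commute power2_eq_square)
  also have "\<dots> \<le> exp 2 * (norm z)\<^sup>2" using \<open>\<bar>Re z\<bar> \<le> 2\<close> by (intro mult_right_mono) auto
  finally show ?thesis .
qed

text \<open>Take a finite \<open>F\<close> whose sum is within \<open>e\<close> of the total; by
  nonnegativity, \<open>F\<close> together with a disjoint finite set still sums to at most the
  total.\<close>

lemma summable_on_small_tail:
  fixes w :: "'a \<Rightarrow> real"
  assumes "w summable_on A" "\<And>a. a \<in> A \<Longrightarrow> w a \<ge> 0" "e > 0"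
  obtains F where "finite F" "\<And>P. finite P \<Longrightarrow> P \<subseteq> A \<Longrightarrow> P \<inter> F = {} \<Longrightarrow> sum w P \<le> e"
proof -
  have "(sum w \<longlongrightarrow> infsum w A) (finite_subsets_at_top A)"
    using has_sum_infsum[OF assms(1)] by (simp add: has_sum_def)
  then have "\<forall>\<^sub>F F in finite_subsets_at_top A. sum w F > infsum w A - e"
    using assms(3) by (intro order_tendstoD) auto
  then obtain F where F: "finite F" "F \<subseteq> A" "sum w F > infsum w A - e"
    unfolding eventually_finite_subsets_at_top by auto
  have "sum w P \<le> e" if "finite P" "P \<subseteq> A" "P \<inter> F = {}" for P
  proof -
    have "sum w P + sum w F = sum w (P \<union> F)" using that F by (simp add: sum.union_disjoint)
    also have "\<dots> \<le> infsum w A"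
      using assms that F by (intro finite_sum_le_infsum) auto
    finally show ?thesis using F by simp
  qed
  with F that show ?thesis by blast
qed

section \<open>Factorisation at small and large primes\<close>

lemma multiplicative_fun_prod_primes:
  assumes "multiplicative_fun g" "finite S" "\<And>p. p \<in> S \<Longrightarrow> prime p"
  shows "g (\<Prod>S) = (\<Prod>p\<in>S. g p)"
  using assms(2,3)
proof (induction S rule: finite_induct)
  case empty
  then show ?case using assms(1) by (simp add: multiplicative_fun_def)
next
  case (insert p S)
  have "coprime p (\<Prod>S)"
    using insert by (intro prod_coprime_right primes_coprime) auto
  moreover have "p > 0" "\<Prod>S > 0"
    using insert by (auto simp: prime_gt_0_nat intro!: prod_pos)
  ultimately show ?case using assms(1) insert by (simp add: multiplicative_fun_def)
qed

lemma squarefree_eq_prod_prime_divisors: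
  fixes k :: nat
  assumes "k > 0" "\<And>p. prime p \<Longrightarrow> \<not> p\<^sup>2 dvd k"
  shows "k = \<Prod>(prime_factors k)"
proof -
  have "multiplicity p k = 1" if "p \<in> prime_factors k" for p
  proof (rule multiplicity_eqI)
    show "p ^ 1 dvd k" "\<not> p ^ Suc 1 dvd k"
      using that assms(2)[of p] by (auto simp: numeral_2_eq_2)
  qed
  then have "(\<Prod>p\<in>prime_factors k. p ^ multiplicity p k) = \<Prod>(prime_factors k)"
    by (intro prod.cong) auto
  with prime_factorization_nat[of k] assms(1) show ?thesis by simp
qed

text \<open>Primes up to \<open>y\<close> occur in \<open>m\<close> with exponent at most
  \<open>K\<close>, so the gcd absorbs them completely. The cofactor has only prime factors above
  \<open>y\<close>; it is coprime to the gcd and squarefree, so \<open>g\<close> of it is a product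
  over its primes.\<close>

lemma multiplicative_fun_split_small_primes:
  fixes m y K :: nat
  assumes g: "multiplicative_fun g" and "m > 0"
    and small: "\<And>p. prime p \<Longrightarrow> p \<le> y \<Longrightarrow> \<not> p ^ Suc K dvd m"
    and large: "\<And>p. prime p \<Longrightarrow> y < p \<Longrightarrow> \<not> p\<^sup>2 dvd m"
  shows "g m = g (gcd m (fact y ^ K)) * (\<Prod>p | prime p \<and> y < p \<and> p dvd m. g p)"
proof -
  define Q :: nat where "Q = fact y ^ K"
  define d where "d = gcd m Q"
  obtain k where k: "m = d * k" unfolding d_def by (meson dvdE gcd_dvd1)
  have "d > 0" "k > 0" using \<open>m > 0\<close> k by (auto intro: Nat.gr0I)
  have k_large: "y < p" if p: "prime p" "p dvd k" for p
  proof (rule ccontr)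
    assume "\<not> y < p"
    then have "p \<le> y" by simp
    \<comment> \<open>If \<open>v\<close> is the exact exponent of \<open>p\<close> in
      \<open>m\<close>, then \<open>p ^ v\<close> already divides \<open>d\<close>, and a further
      factor \<open>p\<close> in \<open>k\<close> would be one too many.\<close>
    define v where "v = multiplicity p m"
    have "p ^ v dvd m" unfolding v_def by (rule multiplicity_dvd)
    moreover have "p ^ v dvd Q"
    proof -
      have "v \<le> K"
        using small[OF p(1) \<open>p \<le> y\<close>] dvd_trans[OF le_imp_power_dvd[of "Suc K" v p] \<open>p ^ v dvd m\<close>]
        by (cases "v \<le> K") auto
      moreover have "p ^ K dvd Q"
        unfolding Q_def using p(1) \<open>p \<le> y\<close> by (intro dvd_power_same) (simp add: prime_dvd_fact_iff)
      ultimately show ?thesis by (rule dvd_trans[OF le_imp_power_dvd])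
    qed
    ultimately have "p ^ v dvd d" by (simp add: d_def)
    then have "p ^ Suc v dvd m" using mult_dvd_mono[OF p(2), of "p ^ v" d] by (simp add: k mult.commute)
    moreover have "\<not> p ^ Suc v dvd m"
      unfolding v_def using p(1) \<open>m > 0\<close> by (subst power_dvd_iff_le_multiplicity) auto
    ultimately show False by blast
  qed
  have d_small: "p \<le> y" if "prime p" "p dvd d" for p
  proof -
    have "p dvd fact y ^ K" using that unfolding d_def Q_def by simp
    then have "p dvd fact y" using prime_dvd_power[OF that(1)] by blast
    then show ?thesis using that(1) by (simp add: prime_dvd_fact_iff)
  qed
  have "coprime d k"
  proof (rule ccontr)
    assume "\<not> coprime d k"
    then obtain p where "prime p" "p dvd d" "p dvd k"
      using prime_factor_nat[of "gcd d k"] by (auto simp: coprime_iff_gcd_eq_1)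
    then show False using k_large[of p] d_small[of p] by simp
  qed
  have eq: "prime_factors k = {p. prime p \<and> y < p \<and> p dvd m}"
  proof (intro equalityI subsetI)
    fix p assume "p \<in> {p. prime p \<and> y < p \<and> p dvd m}"
    then have "prime p" "y < p" "p dvd d * k" using k by auto
    then have "p dvd k" using d_small[of p] prime_dvd_multD[of p d k] by auto
    then show "p \<in> prime_factors k" using \<open>prime p\<close> \<open>k > 0\<close> by (simp add: in_prime_factors_iff)
  qed (auto simp: in_prime_factors_iff k k_large)
  have "\<not> p\<^sup>2 dvd k" if "prime p" for p
  proof
    assume "p\<^sup>2 dvd k"
    then have "y < p" using k_large[OF that] by (simp add: power2_eq_square dvd_mult_left)
    with large[OF that] \<open>p\<^sup>2 dvd k\<close> k show False by simp
  qed
  then have "k = \<Prod>(prime_factors k)"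
    using \<open>k > 0\<close> by (intro squarefree_eq_prod_prime_divisors)
  then have "g k = (\<Prod>p\<in>prime_factors k. g p)"
    using multiplicative_fun_prod_primes[OF g, of "prime_factors k"] by auto
  moreover have "g m = g d * g k"
    using g \<open>coprime d k\<close> \<open>d > 0\<close> \<open>k > 0\<close> unfolding multiplicative_fun_def k by blast
  ultimately show ?thesis unfolding eq d_def Q_def by simp
qed

section \<open>Density of the exceptional integers\<close>

text \<open>Each term is compared with a telescoping difference
  \<open>1 / n - 1 / (n + 1)\<close>.\<close>

lemma sum_inverse_squares_tail_le:
  fixes y N :: nat
  assumes "y \<ge> 1"
  shows "(\<Sum>d\<in>{y<..N}. 1 / (real d)\<^sup>2) \<le> 1 / real y"
proof (cases "y \<le> N")
  case True
  have "(\<Sum>d\<in>{y<..N}. 1 / (real d)\<^sup>2) \<le> 1 / real y - 1 / real N"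
    using True
  proof (induction N rule: dec_induct)
    case (step n)
    have "{y<..Suc n} = insert (Suc n) {y<..n}" using step by auto
    moreover have "1 / (real (Suc n))\<^sup>2 \<le> 1 / real n - 1 / real (Suc n)"
    proof -
      have "real n > 0" using step assms by simp
      then have "1 / real n - 1 / real (Suc n) = 1 / (real n * real (Suc n))" by (simp add: field_simps)
      also have "\<dots> \<ge> 1 / (real (Suc n))\<^sup>2"
        unfolding power2_eq_square using \<open>real n > 0\<close> by (intro divide_left_mono mult_right_mono) auto
      finally show ?thesis .
    qed
    ultimately show ?case using step by simp
  qed simp
  also have "\<dots> \<le> 1 / real y" by simp
  finally show ?thesis .
qed simp

text \<open>These \<open>m\<close> are the ones to which the factorisation above does not apply. A
  union bound over all integers \<open>d\<close> in place of primes suffices: each \<open>d\<close>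
  from 2 to \<open>y\<close> accounts for at most \<open>N / 2 ^ K\<close> values, and the
  \<open>d > y\<close> give the tail of the inverse squares.\<close>

lemma count_prime_power_multiples_le:
  fixes y K N :: nat
  assumes "y \<ge> 1"
  shows "(\<Sum>m=1..N. of_bool (\<exists>p. prime p \<and> (p \<le> y \<and> p ^ Suc K dvd m \<or> y < p \<and> p\<^sup>2 dvd m)))
           \<le> real N * (real y / 2 ^ K + 1 / real y)"
proof -
  have "(\<Sum>m=1..N. of_bool (\<exists>p. prime p \<and> (p \<le> y \<and> p ^ Suc K dvd m \<or> y < p \<and> p\<^sup>2 dvd m)))
     \<le> (\<Sum>m=1..N. (\<Sum>d=2..y. of_bool (d ^ Suc K dvd m)) + (\<Sum>d\<in>{y<..N}. of_bool (d\<^sup>2 dvd m)) :: real)"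
  proof (intro sum_mono)
    fix m assume m: "m \<in> {1..N}"
    define s1 s2 :: real where "s1 = (\<Sum>d=2..y. of_bool (d ^ Suc K dvd m))"
      and "s2 = (\<Sum>d\<in>{y<..N}. of_bool (d\<^sup>2 dvd m))"
    have "s1 \<ge> 0" "s2 \<ge> 0" unfolding s1_def s2_def by (auto intro!: sum_nonneg)
    moreover have "s1 \<ge> 1" if "prime p" "p \<le> y" "p ^ Suc K dvd m" for p
      unfolding s1_def using that member_le_sum[of p "{2..y}" "\<lambda>d. of_bool (d ^ Suc K dvd m) :: real"]
      by (auto simp: prime_ge_2_nat simp del: power_Suc)
    moreover have "s2 \<ge> 1" if "y < p" "p\<^sup>2 dvd m" for p
    proof -
      \<comment> \<open>Since \<open>p * p\<close> divides \<open>m\<close>, it follows that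
        \<open>p \<le> N\<close>, so \<open>p\<close> lies in the finite range of the second
        sum.\<close>
      have "p * 1 \<le> p * p" using that by (intro mult_le_mono) auto
      also have "\<dots> \<le> m" using that m dvd_imp_le[of "p\<^sup>2" m] by (simp add: power2_eq_square)
      finally have "p \<le> N" using m by simp
      then show ?thesis
        unfolding s2_def using that member_le_sum[of p "{y<..N}" "\<lambda>d. of_bool (d\<^sup>2 dvd m) :: real"] by auto
    qed
    ultimately show "of_bool (\<exists>p. prime p \<and> (p \<le> y \<and> p ^ Suc K dvd m \<or> y < p \<and> p\<^sup>2 dvd m)) \<le> s1 + s2"
      unfolding of_bool_def
      by (auto simp del: power_Suc intro: add_increasing add_increasing2)
  qed
  also have "\<dots> = (\<Sum>d=2..y. \<Sum>m=1..N. of_bool (d ^ Suc K dvd m))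
                 + (\<Sum>d\<in>{y<..N}. \<Sum>m=1..N. of_bool (d\<^sup>2 dvd m))"
    by (simp only: sum.distrib sum.swap[of _ "{1..N}"])
  also have "\<dots> \<le> (\<Sum>d=2..y. real N * (1 / 2 ^ K)) + (\<Sum>d\<in>{y<..N}. real N * (1 / (real d)\<^sup>2))"
  proof (intro add_mono sum_mono)
    fix d assume d: "d \<in> {2..y}"
    have "(\<Sum>m=1..N. of_bool (d ^ Suc K dvd m)) \<le> real N / real (d ^ Suc K)"
      using d sum_of_bool_dvd[of "d ^ Suc K" N, where 'a = real] real_div_bounds(1)[of "d ^ Suc K" N]
      by (simp del: power_Suc)
    also have "\<dots> \<le> real N / 2 ^ K"
    proof -
      have "2 ^ K * 1 \<le> real d ^ K * real d" using d by (intro mult_mono power_mono) auto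
      then show ?thesis using d by (intro divide_left_mono) (auto simp: mult.commute)
    qed
    finally show "(\<Sum>m=1..N. of_bool (d ^ Suc K dvd m)) \<le> real N * (1 / 2 ^ K)" by simp
  next
    fix d assume d: "d \<in> {y<..N}"
    then show "(\<Sum>m=1..N. of_bool (d\<^sup>2 dvd m)) \<le> real N * (1 / (real d)\<^sup>2)"
      using sum_of_bool_dvd[of "d\<^sup>2" N, where 'a = real] real_div_bounds(1)[of "d\<^sup>2" N] by simp
  qed
  also have "\<dots> = real N * (real (card {2..y}) * (1 / 2 ^ K) + (\<Sum>d\<in>{y<..N}. 1 / (real d)\<^sup>2))"
    by (simp add: sum_distrib_left algebra_simps)
  also have "\<dots> \<le> real N * (real y * (1 / 2 ^ K) + 1 / real y)"
    using sum_inverse_squares_tail_le[OF assms, of N]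
    by (intro mult_left_mono add_mono mult_right_mono) auto
  finally show ?thesis by simp
qed

section \<open>Additive characters and periodic weights\<close>

text \<open>Orthogonality of the additive characters modulo \<open>Q\<close>: the sum is geometric,
  and its ratio \<open>w\<close> is a \<open>Q\<close>-th root of unity, equal to 1 exactly when
  \<open>Q\<close> divides \<open>n - r\<close>.\<close>

lemma of_bool_mod_eq_character_sum:
  fixes Q n r :: nat
  assumes "r < Q"
  shows "of_bool (n mod Q = r) = (1 / of_nat Q) *
           (\<Sum>b<Q. exp (2 * complex_of_real pi * \<i> * of_nat n * complex_of_real (real b / real Q))
                 * exp (- (2 * complex_of_real pi * \<i> * of_nat r * complex_of_real (real b / real Q))))"
proof -
  define w where "w = exp (2 * complex_of_real pi * \<i> * complex_of_real ((real n - real r) / real Q))"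
  have Q: "Q > 0" using assms by simp
  have "exp (2 * complex_of_real pi * \<i> * of_nat n * complex_of_real (real b / real Q))
      * exp (- (2 * complex_of_real pi * \<i> * of_nat r * complex_of_real (real b / real Q))) = w ^ b" for b
    unfolding w_def by (simp add: exp_of_nat_mult [symmetric] exp_add [symmetric] algebra_simps diff_divide_distrib)
  moreover have "(\<Sum>b<Q. w ^ b) = of_nat Q * of_bool (n mod Q = r)"
  proof (cases "n mod Q = r")
    case True
    then have "real n - real r = real Q * real (n div Q)"
      using div_mult_mod_eq[of n Q]
      by (simp add: algebra_simps flip: of_nat_add of_nat_mult)
    then have "(real n - real r) / real Q = real (n div Q)" using Q by simp
    then have "w = exp (2 * of_nat (n div Q) * complex_of_real pi * \<i>)" by (simp add: w_def mult_ac)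
    also have "\<dots> = 1" using exp_eq_1 by (auto intro!: exI[of _ "int (n div Q)"])
    finally show ?thesis using True by simp
  next
    case False
    have "w \<noteq> 1"
    proof
      assume "w = 1"
      then obtain k :: int where "2 * pi * ((real n - real r) / real Q) = of_int (2 * k) * pi"
        unfolding w_def exp_eq_1 by auto
      then have "pi * (2 * ((real n - real r) / real Q)) = pi * (2 * of_int k)" by (simp add: mult_ac)
      then have "(real n - real r) / real Q = of_int k" by (simp only: mult_cancel_left) simp
      then have "real n - real r = of_int k * real Q" using Q by (simp add: field_simps)
      \<comment> \<open>The congruence is derived over the integers because \<open>n - r\<close> may
        be negative.\<close>
      then have "of_int (int n - int r) = (of_int (k * int Q) :: real)" by simp
      then have "int n - int r = k * int Q" by (simp only: of_int_eq_iff)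
      then have "int n = int r + k * int Q" by simp
      then have "int n mod int Q = int r mod int Q" by simp
      then have "n mod Q = r mod Q" by (simp flip: of_nat_mod)
      then show False using False assms by simp
    qed
    moreover have "w ^ Q = 1"
    proof -
      have "w ^ Q = exp (2 * complex_of_real pi * \<i> * complex_of_real (real n - real r))"
        unfolding w_def exp_of_nat_mult [symmetric]
        using Q by (intro arg_cong[where f = exp]) (simp add: mult_ac)
      also have "\<dots> = 1"
        unfolding exp_eq_1 by (auto intro!: exI[of _ "int n - int r"])
      finally show ?thesis .
    qed
    ultimately show ?thesis using False by (simp add: sum_gp_strict)
  qed
  ultimately show ?thesis using Q by simp
qed

text \<open>The indicator of a residue class is an average of \<open>Q\<close> characters with
  unimodular coefficients, so the sum over one class inherits the bound \<open>B\<close>. The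
  periodic weight combines \<open>Q\<close> classes with coefficients of modulus at most 1.\<close>

lemma norm_sum_periodic_le:
  fixes a h :: "nat \<Rightarrow> complex" and X Q :: nat
  assumes a: "\<And>\<beta>. norm (\<Sum>n=1..X. a n * exp (2 * complex_of_real pi * \<i> * of_nat n * complex_of_real \<beta>)) \<le> B"
    and Q: "Q > 0" and h: "\<And>n. norm (h n) \<le> 1"
  shows "norm (\<Sum>n=1..X. a n * h (n mod Q)) \<le> real Q * B"
proof -
  have "norm (\<Sum>n=1..X. a n * of_bool (n mod Q = r)) \<le> B" if "r < Q" for r
  proof -
    define E where "E b k = exp (2 * complex_of_real pi * \<i> * of_nat k * complex_of_real (real b / real Q))"
      for b k :: nat
    define E' where "E' b k = exp (- (2 * complex_of_real pi * \<i> * of_nat k * complex_of_real (real b / real Q)))"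
      for b k :: nat
    have "(\<Sum>n=1..X. a n * of_bool (n mod Q = r))
        = (\<Sum>n=1..X. \<Sum>b<Q. (1 / of_nat Q) * (E' b r * (a n * E b n)))"
      unfolding of_bool_mod_eq_character_sum[OF that] E_def [symmetric] E'_def [symmetric]
      by (simp add: sum_distrib_left mult_ac)
    also have "\<dots> = (\<Sum>b<Q. (1 / of_nat Q) * (E' b r * (\<Sum>n=1..X. a n * E b n)))"
      by (subst sum.swap) (simp add: sum_distrib_left)
    finally have "norm (\<Sum>n=1..X. a n * of_bool (n mod Q = r))
        \<le> (\<Sum>b<Q. norm ((1 / of_nat Q) * (E' b r * (\<Sum>n=1..X. a n * E b n))))"
      by (simp only: norm_sum)
    also have "\<dots> \<le> (\<Sum>b<Q. (1 / real Q) * B)"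
    proof (intro sum_mono)
      fix b
      have "norm (E' b r) = 1" by (simp add: E'_def)
      then have "norm ((1 / of_nat Q) * (E' b r * (\<Sum>n=1..X. a n * E b n)))
          = (1 / real Q) * norm (\<Sum>n=1..X. a n * E b n)"
        by (simp only: norm_mult norm_divide norm_of_nat norm_one mult_1)
      also have "\<dots> \<le> (1 / real Q) * B"
        using a[of "real b / real Q"] unfolding E_def by (intro mult_left_mono) auto
      finally show "norm ((1 / of_nat Q) * (E' b r * (\<Sum>n=1..X. a n * E b n))) \<le> (1 / real Q) * B" .
    qed
    finally show ?thesis using Q by simp
  qed
  note progression = this
  have "(\<Sum>n=1..X. a n * h (n mod Q)) = (\<Sum>n=1..X. \<Sum>r<Q. h r * (a n * of_bool (n mod Q = r)))"
  proof (intro sum.cong refl)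
    fix n
    have "(\<Sum>r<Q. h r * (a n * of_bool (n mod Q = r))) = (\<Sum>r<Q. if n mod Q = r then a n * h r else 0)"
      by (intro sum.cong) auto
    then show "a n * h (n mod Q) = (\<Sum>r<Q. h r * (a n * of_bool (n mod Q = r)))"
      using Q by simp
  qed
  also have "\<dots> = (\<Sum>r<Q. h r * (\<Sum>n=1..X. a n * of_bool (n mod Q = r)))"
    by (subst sum.swap) (simp only: sum_distrib_left)
  finally have "norm (\<Sum>n=1..X. a n * h (n mod Q))
      \<le> (\<Sum>r<Q. norm (h r * (\<Sum>n=1..X. a n * of_bool (n mod Q = r))))"
    by (simp only: norm_sum)
  also have "\<dots> \<le> (\<Sum>r<Q. 1 * B)"
    unfolding norm_mult using h progression by (intro sum_mono mult_mono) auto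
  finally show ?thesis by simp
qed

section \<open>Approximation in mean by a periodic function\<close>

text \<open>The order of the choices matters: \<open>Q\<close> is fixed before \<open>N\<close>,
  whereas \<open>c\<close> may vary with \<open>N\<close>. The constant will be
  \<open>exp A\<close>, where \<open>A\<close> is the approximate mean of the exponent.\<close>

lemma multiplicative_fun_approx_periodic:
  assumes g: "multiplicative_fun g" and bounded: "\<And>n. n > 0 \<Longrightarrow> norm (g n) \<le> 1"
    and close: "(\<lambda>p. (norm (g p - 1))\<^sup>2 / real p) summable_on {p::nat. prime p}"
    and "e > 0"
  obtains Q :: nat where "Q > 0"
    "\<And>N. \<exists>c. norm c \<le> 1 \<and> (\<Sum>m=1..N. norm (g m - c * g (gcd m Q))) \<le> e * real N"
proof -
  define z where "z p = g p - 1" for p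
  \<comment> \<open>The errors add up to \<open>4 + exp 2 + 1 + 2\<close> times
    \<open>\<eta>\<close>: exceptional integers, exponentials replacing \<open>g p\<close>, primes
    above the square root, and the Turan-Kubilius step. The cap at 1 makes the square of
    \<open>\<eta>\<close> at most \<open>\<eta>\<close>.\<close>
  define \<eta> where "\<eta> = min 1 (e / (exp 2 + 7))"
  have "exp 2 + 7 > (0::real)" by (simp add: add_pos_pos)
  then have \<eta>: "\<eta> > 0" "\<eta> \<le> 1" "(exp 2 + 7) * \<eta> \<le> e"
    using \<open>e > 0\<close> pos_le_divide_eq[of "exp 2 + 7" \<eta> e]
    by (auto simp: \<eta>_def mult.commute)
  obtain F where F: "finite F"
    "\<And>P. finite P \<Longrightarrow> P \<subseteq> {p. prime p} \<Longrightarrow> P \<inter> F = {} \<Longrightarrow> (\<Sum>p\<in>P. (norm (z p))\<^sup>2 / real p) \<le> \<eta>\<^sup>2"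
    using summable_on_small_tail[OF close, of "\<eta>\<^sup>2"] \<eta>(1) unfolding z_def by auto
  obtain y0 where y0: "F \<subseteq> {..y0}" using F(1) finite_nat_iff_bounded_le by blast
  obtain y1 :: nat where y1: "1 / \<eta> \<le> real y1" using real_arch_simple by blast
  \<comment> \<open>Beyond every element of \<open>F\<close>, so that the tail bound covers all
    primes above \<open>y\<close>, and at least \<open>1 / \<eta>\<close>, so that few integers have
    a large square factor.\<close>
  define y where "y = Suc (max y0 y1)"
  have "y \<ge> 1" by (simp add: y_def)
  have "1 / \<eta> \<le> real y" using y1 by (simp add: y_def)
  then have y: "1 / real y \<le> \<eta>" using \<eta>(1) \<open>y \<ge> 1\<close> by (simp add: field_simps)
  have tail: "(\<Sum>p\<in>P. (norm (z p))\<^sup>2 / real p) \<le> \<eta>\<^sup>2"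
    if "finite P" "\<And>p. p \<in> P \<Longrightarrow> prime p \<and> y < p" for P
  proof (rule F(2))
    have "p \<notin> F" if "p \<in> P" for p
      using \<open>\<And>p. p \<in> P \<Longrightarrow> prime p \<and> y < p\<close>[OF that] y0 by (auto simp: y_def)
    then show "P \<inter> F = {}" by blast
  qed (use that in auto)
  obtain K where "real y / \<eta> < 2 ^ K" using real_arch_pow[of 2 "real y / \<eta>"] by auto
  then have K: "real y / 2 ^ K \<le> \<eta>" using \<eta>(1) by (simp add: field_simps)
  define Q :: nat where "Q = fact y ^ K"
  have "Q > 0" by (simp add: Q_def)
  \<comment> \<open>This keeps all exponents in the left half plane, where \<open>exp\<close> has
    modulus at most 1 and is 1-Lipschitz.\<close>
  have Re_z: "Re (z p) \<le> 0" if "prime p" for p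
    using complex_Re_le_cmod[of "g p"] bounded[of p] prime_gt_0_nat[OF that] by (simp add: z_def)
  have "\<exists>c. norm c \<le> 1 \<and> (\<Sum>m=1..N. norm (g m - c * g (gcd m Q))) \<le> e * real N" for N
  \<comment> \<open>The witness stays schematic until the bound on \<open>exp A\<close> fixes
    it.\<close>
  proof (intro exI conjI)
    define P where "P = {p. prime p \<and> y < p \<and> p * p \<le> N}"
    define L where "L = {p. prime p \<and> y < p \<and> p \<le> N \<and> N < p * p}"
    have "p \<le> N" if "p \<in> P" for p using that by (cases p) (auto simp: P_def)
    then have "P \<subseteq> {..N}" "L \<subseteq> {..N}" by (auto simp: L_def)
    then have fin: "finite P" "finite L" by (auto intro: finite_subset)
    have "P \<inter> L = {}" by (auto simp: P_def L_def)
    \<comment> \<open>\<open>f m\<close> is the exponent after replacing \<open>g p\<close> by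
      \<open>exp (z p)\<close>; \<open>A\<close> replaces each divisibility indicator by its
      density.\<close>
    define f where "f m = (\<Sum>p\<in>P. z p * of_bool (p dvd m))" for m
    define A where "A = (\<Sum>p\<in>P. z p / of_nat p)"
    define bad where "bad m \<longleftrightarrow> (\<exists>p. prime p \<and> (p \<le> y \<and> p ^ Suc K dvd m \<or> y < p \<and> p\<^sup>2 dvd m))"
      for m
    have Re_A: "Re A \<le> 0"
      unfolding A_def Re_sum
      by (intro sum_nonpos) (auto simp: P_def Re_z divide_nonpos_nonneg Re_divide_of_nat)
    then show c: "norm (exp A) \<le> 1" by simp
    have Re_f: "Re (f m) \<le> 0" for m
      unfolding f_def Re_sum by (intro sum_nonpos) (auto simp: P_def Re_z of_bool_def)
    have G: "norm (g (gcd m Q)) \<le> 1" for m using bounded \<open>Q > 0\<close> by simp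
    have pointwise: "norm (g m - exp A * g (gcd m Q)) \<le> 2 * of_bool (bad m)
        + (\<Sum>p\<in>P. exp 2 * (norm (z p))\<^sup>2 * of_bool (p dvd m))
        + (\<Sum>p\<in>L. norm (z p) * of_bool (p dvd m)) + norm (f m - A)"
      (is "_ \<le> _ + ?s1 + ?s2 + _") if m: "m \<in> {1..N}" for m
    proof (cases "bad m")
      case True
      have "norm (g m - exp A * g (gcd m Q)) \<le> norm (g m) + norm (exp A) * norm (g (gcd m Q))"
        using norm_triangle_ineq4[of "g m" "exp A * g (gcd m Q)"] by (simp add: norm_mult)
      also have "\<dots> \<le> 1 + 1 * 1"
        using m bounded c G by (intro add_mono mult_mono) auto
      finally have "norm (g m - exp A * g (gcd m Q)) \<le> 2" by simp
      moreover have "?s1 \<ge> 0" "?s2 \<ge> 0" by (auto intro!: sum_nonneg)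
      moreover have "norm (f m - A) \<ge> 0" by simp
      moreover have "2 * of_bool (bad m) = (2 :: real)" using True by simp
      ultimately show ?thesis by linarith
    next
      case False
      define S where "S = {p. prime p \<and> y < p \<and> p dvd m}"
      have S: "S = {p \<in> P \<union> L. p dvd m}"
      proof -
        have "p \<le> N" if "p dvd m" for p using m dvd_imp_le[OF that] by simp
        then show ?thesis by (auto simp: S_def P_def L_def)
      qed
      \<comment> \<open>The model factors: primes in \<open>L\<close> are dropped from the model, at
        a cost of \<open>norm (z p)\<close> each.\<close>
      define b where "b p = (if p \<in> P then exp (z p) else 1)" for p
      have gm: "g m = g (gcd m Q) * (\<Prod>p\<in>S. g p)"
        unfolding S_def Q_def using False m
        by (intro multiplicative_fun_split_small_primes[OF g]) (auto simp: bad_def)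
      have "(\<Prod>p\<in>S. b p) = (\<Prod>p\<in>{p \<in> P. p dvd m}. exp (z p))"
        unfolding b_def using fin by (intro prod.mono_neutral_cong_right) (auto simp: S)
      also have "\<dots> = exp (\<Sum>p\<in>{p \<in> P. p dvd m}. z p)"
        using fin by (simp add: exp_sum)
      also have "(\<Sum>p\<in>{p \<in> P. p dvd m}. z p) = f m"
        unfolding f_def using fin by (intro sum.mono_neutral_cong_left) auto
      finally have prod_b: "(\<Prod>p\<in>S. b p) = exp (f m)" .
      \<comment> \<open>All factors have modulus at most 1, so exchanging them one at a time costs
        only the sum of the individual differences.\<close>
      have "norm ((\<Prod>p\<in>S. g p) - (\<Prod>p\<in>S. b p)) \<le> (\<Sum>p\<in>S. norm (g p - b p))"
        by (rule norm_prod_diff) (auto simp: S_def b_def bounded prime_gt_0_nat Re_z)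
      also have "\<dots> = (\<Sum>p\<in>P \<union> L. norm (g p - b p) * of_bool (p dvd m))"
        using fin by (intro sum.mono_neutral_cong_left) (auto simp: S)
      also have "\<dots> = (\<Sum>p\<in>P. norm (g p - b p) * of_bool (p dvd m))
                    + (\<Sum>p\<in>L. norm (g p - b p) * of_bool (p dvd m))"
        using fin \<open>P \<inter> L = {}\<close> by (rule sum.union_disjoint)
      also have "\<dots> \<le> ?s1 + ?s2"
      proof (intro add_mono sum_mono mult_right_mono)
        fix p assume "p \<in> P"
        then have "norm (1 + z p) \<le> 1" by (auto simp: P_def z_def bounded prime_gt_0_nat)
        then show "norm (g p - b p) \<le> exp 2 * (norm (z p))\<^sup>2"
          using norm_one_plus_minus_exp_le[of "z p"] \<open>p \<in> P\<close> by (simp add: b_def z_def)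
      next
        fix p assume "p \<in> L"
        then show "norm (g p - b p) \<le> norm (z p)"
          using \<open>P \<inter> L = {}\<close> by (auto simp: b_def z_def)
      qed auto
      finally have 1: "norm ((\<Prod>p\<in>S. g p) - exp (f m)) \<le> ?s1 + ?s2" unfolding prod_b .
      have 2: "norm (exp (f m) - exp A) \<le> norm (f m - A)"
        using Re_f Re_A by (rule norm_exp_diff_le)
      have "norm (g m - exp A * g (gcd m Q)) = norm (g (gcd m Q)) * norm ((\<Prod>p\<in>S. g p) - exp A)"
        unfolding gm by (simp add: norm_mult [symmetric] algebra_simps)
      also have "\<dots> \<le> norm ((\<Prod>p\<in>S. g p) - exp A)"
        using G by (intro mult_left_le_one_le) auto
      also have "\<dots> \<le> norm ((\<Prod>p\<in>S. g p) - exp (f m)) + norm (exp (f m) - exp A)"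
        by (rule norm_diff_triangle_le[OF order_refl order_refl])
      also have "\<dots> \<le> 0 + ?s1 + ?s2 + norm (f m - A)" using 1 2 by linarith
      finally show ?thesis using False by simp
    qed
    have "(\<Sum>m=1..N. norm (g m - exp A * g (gcd m Q)))
        \<le> (\<Sum>m=1..N. 2 * of_bool (bad m)
            + (\<Sum>p\<in>P. exp 2 * (norm (z p))\<^sup>2 * of_bool (p dvd m))
            + (\<Sum>p\<in>L. norm (z p) * of_bool (p dvd m)) + norm (f m - A))"
      by (rule sum_mono) (rule pointwise)
    also have "\<dots> = 2 * (\<Sum>m=1..N. of_bool (bad m))
        + (\<Sum>m=1..N. \<Sum>p\<in>P. exp 2 * (norm (z p))\<^sup>2 * of_bool (p dvd m))
        + (\<Sum>m=1..N. \<Sum>p\<in>L. norm (z p) * of_bool (p dvd m)) + (\<Sum>m=1..N. norm (f m - A))"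
      by (simp only: sum.distrib sum_distrib_left)
    also have "\<dots> \<le> 2 * (real N * (2 * \<eta>)) + real N * (exp 2 * \<eta>) + real N * \<eta> + real N * (2 * \<eta>)"
    proof (intro add_mono mult_left_mono)
      have "(\<Sum>m=1..N. of_bool (bad m)) \<le> real N * (real y / 2 ^ K + 1 / real y)"
        unfolding bad_def using \<open>y \<ge> 1\<close> by (rule count_prime_power_multiples_le)
      also have "\<dots> \<le> real N * (2 * \<eta>)" using K y by (intro mult_left_mono) auto
      finally show "(\<Sum>m=1..N. of_bool (bad m)) \<le> real N * (2 * \<eta>)" .
    next
      have "(\<Sum>m=1..N. \<Sum>p\<in>P. exp 2 * (norm (z p))\<^sup>2 * of_bool (p dvd m))
          \<le> real N * (\<Sum>p\<in>P. exp 2 * (norm (z p))\<^sup>2 / real p)"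
        by (intro sum_sum_dvd_le) (auto simp: P_def prime_gt_0_nat)
      also have "\<dots> = real N * (exp 2 * (\<Sum>p\<in>P. (norm (z p))\<^sup>2 / real p))"
        by (simp add: sum_distrib_left)
      also have "\<dots> \<le> real N * (exp 2 * \<eta>)"
      proof -
        have "(\<Sum>p\<in>P. (norm (z p))\<^sup>2 / real p) \<le> \<eta>\<^sup>2" using fin by (intro tail) (auto simp: P_def)
        also have "\<eta>\<^sup>2 \<le> \<eta>" using \<eta> by (simp add: power2_eq_square mult_left_le_one_le)
        finally show ?thesis by (intro mult_left_mono) auto
      qed
      finally show "(\<Sum>m=1..N. \<Sum>p\<in>P. exp 2 * (norm (z p))\<^sup>2 * of_bool (p dvd m)) \<le> real N * (exp 2 * \<eta>)" .
    next
      show "(\<Sum>m=1..N. \<Sum>p\<in>L. norm (z p) * of_bool (p dvd m)) \<le> real N * \<eta>"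
        using fin \<eta> by (intro sum_large_prime_divisors_le tail) (auto simp: L_def)
    next
      \<comment> \<open>The Turan-Kubilius constant 3 is rounded up to 4 to obtain the square of
        \<open>2 * \<eta>\<close>.\<close>
      show "(\<Sum>m=1..N. norm (f m - A)) \<le> real N * (2 * \<eta>)"
      proof (rule sum_le_of_sum_squares_le)
        have "f m - A = (\<Sum>p\<in>P. z p * of_real (of_bool (p dvd m) - 1 / real p))" for m
          unfolding f_def A_def sum_subtractf [symmetric] by (intro sum.cong) (auto simp: algebra_simps)
        then have "(\<Sum>m=1..N. (norm (f m - A))\<^sup>2)
            = (\<Sum>m=1..N. (norm (\<Sum>p\<in>P. z p * of_real (of_bool (p dvd m) - 1 / real p)))\<^sup>2)"
          by (simp only:)
        also have "\<dots> \<le> 3 * real N * (\<Sum>p\<in>P. (norm (z p))\<^sup>2 / real p)"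
          using fin(1) by (rule turan_kubilius_sqrt) (auto simp: P_def)
        also have "\<dots> \<le> 3 * real N * \<eta>\<^sup>2"
          using fin by (intro mult_left_mono tail) (auto simp: P_def)
        also have "\<dots> \<le> real N * (2 * \<eta>)\<^sup>2" by (simp add: power_mult_distrib)
        finally show "(\<Sum>m=1..N. (norm (f m - A))\<^sup>2) \<le> real N * (2 * \<eta>)\<^sup>2" .
      qed (use \<eta> in auto)
    qed auto
    also have "\<dots> = ((exp 2 + 7) * \<eta>) * real N" by (simp add: algebra_simps)
    also have "\<dots> \<le> e * real N" using \<eta>(3) by (intro mult_right_mono) auto
    finally show "(\<Sum>m=1..N. norm (g m - exp A * g (gcd m Q))) \<le> e * real N" .
  qed
  with \<open>Q > 0\<close> that show ?thesis by blast
qed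

section \<open>Correlation with the shifted Moebius product\<close>

lemma norm_moebius_mu_le: "norm (of_int (moebius_mu n) :: complex) \<le> 1"
  by (simp add: moebius_mu_def norm_power)

theorem theorem5:
  fixes g1 :: "nat \<Rightarrow> complex"
  assumes exp_sum_bound:
    "\<forall>A::real. A > 0 \<longrightarrow> (\<exists>C::real. \<forall>\<^sub>F x::real in at_top. \<forall>\<beta>::real.
       norm (\<Sum>n=1..nat \<lfloor>x\<rfloor>. of_int (moebius_mu (n + 2)) * of_int (moebius_mu (n + 1)) *
               exp (2 * complex_of_real pi * \<i> * of_nat n * complex_of_real \<beta>))
         \<le> C * (x / (ln x) powr A))"
    and mult: "multiplicative_fun g1"
    and bounded: "\<forall>n>0. norm (g1 n) \<le> 1"
    and close_to_1: "(\<lambda>p. (norm (g1 p - 1))\<^sup>2 / real p) summable_on {p::nat. prime p}"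
  shows "(\<lambda>x::real. (1 / complex_of_real x) *
            (\<Sum>n=1..nat \<lfloor>x\<rfloor>. g1 (n + 3) * of_int (moebius_mu (n + 2)) * of_int (moebius_mu (n + 1))))
         \<in> o[at_top](\<lambda>_. 1)"
proof (rule landau_o.smallI)
  fix e :: real assume "e > 0"
  define a :: "nat \<Rightarrow> complex" where "a n = of_int (moebius_mu (n + 2)) * of_int (moebius_mu (n + 1))" for n
  have a: "norm (a n) \<le> 1" for n
    unfolding a_def norm_mult by (intro mult_le_one norm_moebius_mu_le) auto
  obtain Q where Q: "Q > 0"
    "\<And>N. \<exists>c. norm c \<le> 1 \<and> (\<Sum>m=1..N. norm (g1 m - c * g1 (gcd m Q))) \<le> (e / 4) * real N"
    using multiplicative_fun_approx_periodic[OF mult _ close_to_1, of "e / 4"] bounded \<open>e > 0\<close> by auto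
  \<comment> \<open>The exponent 1 is chosen: since \<open>Q\<close> is fixed, one saved logarithm
    outweighs the factor \<open>real Q * C\<close>.\<close>
  obtain C where C: "\<forall>\<^sub>F x::real in at_top. \<forall>\<beta>::real.
       norm (\<Sum>n=1..nat \<lfloor>x\<rfloor>. a n * exp (2 * complex_of_real pi * \<i> * of_nat n * complex_of_real \<beta>))
         \<le> C * (x / (ln x) powr 1)"
    using exp_sum_bound unfolding a_def by (meson zero_less_one)
  have "((\<lambda>x::real. real Q * C / ln x) \<longlongrightarrow> 0) at_top"
    by (intro tendsto_divide_0[OF tendsto_const] filterlim_at_top_imp_at_infinity ln_at_top)
  then have "\<forall>\<^sub>F x::real in at_top. real Q * C / ln x < e / 2"
    using \<open>e > 0\<close> by (intro order_tendstoD) auto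
  with C show "\<forall>\<^sub>F x in at_top. norm ((1 / complex_of_real x) *
      (\<Sum>n=1..nat \<lfloor>x\<rfloor>. g1 (n + 3) * of_int (moebius_mu (n + 2)) * of_int (moebius_mu (n + 1))))
        \<le> e * norm (1 :: complex)"
    \<comment> \<open>The bound \<open>x \<ge> 3\<close> gives \<open>ln x > 0\<close> and
      \<open>X + 3 \<le> 2 * x\<close>.\<close>
    using eventually_ge_at_top[of 3]
  proof eventually_elim
    case (elim x)
    define X where "X = nat \<lfloor>x\<rfloor>"
    have X: "real X \<le> x" using elim by (simp add: X_def)
    have "ln x > 0" using elim by simp
    obtain c where c: "norm c \<le> 1"
      "(\<Sum>m=1..X+3. norm (g1 m - c * g1 (gcd m Q))) \<le> (e / 4) * real (X + 3)"
      using Q(2)[of "X + 3"] by blast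
    define h where "h n = g1 (gcd (n + 3) Q)" for n
    have h: "norm (h n) \<le> 1" for n using bounded Q(1) by (simp add: h_def)
    \<comment> \<open>The gcd with \<open>Q\<close> depends only on the residue modulo
      \<open>Q\<close>, so \<open>h\<close> is periodic and the character bound applies.\<close>
    have h_mod: "h (n mod Q) = h n" for n
      unfolding h_def by (metis gcd.commute gcd_red_nat mod_add_left_eq)
    have "norm (\<Sum>n=1..X. a n * h (n mod Q)) \<le> real Q * (C * (x / (ln x) powr 1))"
      using elim(1) Q(1) h unfolding X_def by (intro norm_sum_periodic_le) auto
    then have "norm (\<Sum>n=1..X. a n * h n) \<le> (real Q * C / ln x) * x"
      using \<open>ln x > 0\<close> by (simp add: h_mod)
    also have "\<dots> \<le> (e / 2) * x" using elim by (intro mult_right_mono) auto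
    finally have main: "norm (\<Sum>n=1..X. a n * h n) \<le> (e / 2) * x" .
    \<comment> \<open>The substitution \<open>m = n + 3\<close> reaches \<open>X + 3\<close>, hence
      that cutoff in the approximation; the missing terms 1, 2, 3 are nonnegative.\<close>
    have "(\<Sum>n=1..X. norm (g1 (n + 3) - c * h n)) = (\<Sum>m\<in>{4..X+3}. norm (g1 m - c * g1 (gcd m Q)))"
      unfolding h_def using sum.shift_bounds_cl_nat_ivl[of "\<lambda>m. norm (g1 m - c * g1 (gcd m Q))" 1 3 X]
      by (simp add: add.commute)
    also have "\<dots> \<le> (\<Sum>m=1..X+3. norm (g1 m - c * g1 (gcd m Q)))"
      by (intro sum_mono2) auto
    also have "\<dots> \<le> (e / 4) * real (X + 3)" by (rule c)
    also have "\<dots> \<le> (e / 4) * (2 * x)" using X elim \<open>e > 0\<close> by (intro mult_left_mono) auto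
    finally have err: "(\<Sum>n=1..X. norm (g1 (n + 3) - c * h n)) \<le> (e / 2) * x" by simp
    \<comment> \<open>The approximation error and the periodic main term each contribute at most
      \<open>(e / 2) * x\<close>.\<close>
    have "(\<Sum>n=1..X. g1 (n + 3) * of_int (moebius_mu (n + 2)) * of_int (moebius_mu (n + 1)))
        = (\<Sum>n=1..X. (g1 (n + 3) - c * h n) * a n) + c * (\<Sum>n=1..X. a n * h n)"
      unfolding sum_distrib_left sum.distrib [symmetric] a_def by (intro sum.cong) (auto simp: algebra_simps)
    also have "norm \<dots> \<le> (\<Sum>n=1..X. norm ((g1 (n + 3) - c * h n) * a n)) + norm c * norm (\<Sum>n=1..X. a n * h n)"
      by (rule norm_triangle_le) (simp add: norm_mult norm_sum add_mono sum_norm_le)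
    also have "\<dots> \<le> (\<Sum>n=1..X. norm (g1 (n + 3) - c * h n)) + 1 * norm (\<Sum>n=1..X. a n * h n)"
      using a c by (intro add_mono sum_mono mult_right_mono) (auto simp: norm_mult mult_left_le)
    also have "\<dots> \<le> e * x" using main err by (simp add: field_simps)
    finally have "norm (\<Sum>n=1..X. g1 (n + 3) * of_int (moebius_mu (n + 2)) * of_int (moebius_mu (n + 1)))
        \<le> e * x" .
    then show ?case using elim by (simp add: norm_mult norm_divide X_def field_simps)
  qed
qed

end
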